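(* Assume that each local objective function $f_i$ is $L$-smooth for some constant $L>0$ common to all $i$, and that the global objective function $f$ is $\mu$-gradient dominated and achieves its global minimum at $x^\ast$. Let $(x^i(t),s^i(t))$ be generated by Algorithm 2 with constant step size $\eta$ satisfying $$\eta L= \alpha\cdot \left(\frac{\mu}{L}\right)^{\frac{1}{3}}\frac{(1-\rho^2)^2}{14}$$ for some $\alpha \in(0,1]$, and suppose $(u_t)_{t\geq 1}$ is non-increasing. Let $$\lambda:= 1-\alpha\Big(\frac{1-\rho^2}{5}\Big)^2\Big(\frac{\mu}{L}\Big)^{\frac{4}{3}}.$$ Then $$f(\bar x(t))-f(x^\ast)\leq O(\lambda^t)+5(1-\rho^2)Ld\sum_{\tau=0}^{t-1}\lambda^\tau u^2_{t-\tau},$$ $$\frac{1}{n}\sum_{i=1}^n\| x^i(t)-\bar x(t)\|^2\leq O(\lambda^t)+\frac{3\eta Ld}{1-\rho^2}\sum_{\tau=0}^{t-1}\lambda^\tau u^2_{t-\tau},$$ $$\frac{1}{n}\sum_{i=1}^n \|s^i(t)-\nabla f(\bar x(t-1))\|^2\leq O(\lambda^t) + \frac{18L^2d}{1-\rho^2}\sum_{\tau=0}^{t-1}\lambda^{\tau} u_{t-\tau}^2,$$ where each $O(\lambda^t)$ denotes a quantity bounded by $C\lambda^t$ with $C$ independent of $t$.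
   Context: Setting: $n$ agents are the nodes of an undirected connected graph $\mathcal{G}=(\{1,\dots,n\},\mathcal{E})$; agent $i$ has a local objective $f_i:\mathbb{R}^d\to\mathbb{R}$, and $f=\frac1n\sum_{i=1}^n f_i$. $\|\cdot\|$ is the $\ell_2$ norm. A function $h:\mathbb{R}^d\to\mathbb{R}$ is $L$-smooth if it is continuously differentiable with $\|\nabla h(x)-\nabla h(y)\|\le L\|x-y\|$ for all $x,y$; for $\mu>0$ it is $\mu$-gradient dominated if it is differentiable, has a global minimizer $x^\ast$, and $2\mu(h(x)-h(x^\ast))\le\|\nabla h(x)\|^2$ for all $x$. Consensus matrix: $W=[W_{ij}]\in\mathbb{R}^{n\times n}$ is doubly stochastic, $W_{ii}>0$ for all $i$, and for $i\ne j$, $W_{ij}>0$ if and only if $(i,j)\in\mathcal{E}$. Put $\rho:=\|W-n^{-1}\mathbf{1}_n\mathbf{1}_n^\top\|$ (spectral norm); it is known that $\rho<1$. $2d$-point gradient estimator: for $u>0$, $\mathsf{G}^{(2d)}_h(x;u):=\sum_{k=1}^d\frac{h(x+ue_k)-h(x-ue_k)}{2u}e_k$, with $\{e_k\}_{k=1}^d$ the standard basis of $\mathbb{R}^d$. Algorithm 2 (with constant step size $\eta>0$ and radii $u_t>0$): given initial points $x^i(0)\in\mathbb{R}^d$, set $s^i(0)=g^i(0)=0$ for each $i$; for $t=1,2,\dots$ and each $i$ set $g^i(t)=\mathsf{G}^{(2d)}_{f_i}(x^i(t-1);u_t)$, $s^i(t)=\sum_{j=1}^n W_{ij}(s^j(t-1)+g^j(t)-g^j(t-1))$,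 and $x^i(t)=\sum_{j=1}^n W_{ij}(x^j(t-1)-\eta s^j(t))$. Notation: $\bar x(t):=\frac1n\sum_{i=1}^n x^i(t)$.
   Formalization: If the global objective f is constant, μ ≤ L is additionally assumed; a constant f is μ-gradient dominated for every μ > 0, and the claim then fails, e.g. for all f_i = 0 with μ/L chosen so that λ = 0 and rapidly decaying u_t. For nonconstant f nothing is added. *)

theory Defs
  imports "HOL-Analysis.Analysis"
begin

definition grad :: "('a::euclidean_space \<Rightarrow> real) \<Rightarrow> 'a \<Rightarrow> 'a" where
  "grad h x = (THE D. GDERIV h x :> D)"

lemma GDERIV_grad:
  fixes h :: "'a::euclidean_space \<Rightarrow> real"
  assumes "h differentiable (at x)"
  shows "GDERIV h x :> grad h x"
proof -
  obtain h' where h': "(h has_derivative h') (at x)"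
    using assms by (auto simp: differentiable_def)
  define D where "D = (\<Sum>b\<in>Basis. h' b *\<^sub>R b)"
  have "h' v = inner v D" for v
  proof -
    have "h' v = h' (\<Sum>b\<in>Basis. inner v b *\<^sub>R b)"
      by (simp add: euclidean_representation)
    also have "\<dots> = (\<Sum>b\<in>Basis. inner v b * h' b)"
      using has_derivative_linear[OF h'] by (simp add: linear_sum linear_scale)
    also have "\<dots> = inner v D"
      by (simp add: D_def inner_sum_right mult.commute)
    finally show ?thesis .
  qed
  then have "h' = (\<lambda>v. inner v D)"
    by (rule ext)
  then have "GDERIV h x :> D"
    using h' by (simp add: gderiv_def)
  moreover have "D' = D" if "GDERIV h x :> D'" for D'
  proof -
    have "(\<lambda>v. inner v D') = (\<lambda>v. inner v D)"
      using that \<open>GDERIV h x :> D\<close> unfolding gderiv_def by (rule has_derivative_unique)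
    then show ?thesis
      by (metis vector_eq_ldot)
  qed
  ultimately show ?thesis
    unfolding grad_def by (rule theI)
qed

definition smooth :: "real \<Rightarrow> ('a::euclidean_space \<Rightarrow> real) \<Rightarrow> bool" where
  "smooth L h \<longleftrightarrow>
     (\<forall>x. h differentiable (at x)) \<and> continuous_on UNIV (grad h) \<and>
     (\<forall>x y. norm (grad h x - grad h y) \<le> L * norm (x - y))"

definition global_minimizer :: "('a \<Rightarrow> real) \<Rightarrow> 'a \<Rightarrow> bool" where
  "global_minimizer h x \<longleftrightarrow> (\<forall>y. h x \<le> h y)"

text \<open>A constant function is \<open>\<mu>\<close>-gradient dominated for every \<open>\<mu> > 0\<close>; a nonconstant
  \<open>L\<close>-smooth function can only be so for \<open>\<mu> \<le> L\<close>.\<close>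

definition gradient_dominated :: "real \<Rightarrow> ('a::euclidean_space \<Rightarrow> real) \<Rightarrow> bool" where
  "gradient_dominated \<mu> h \<longleftrightarrow>
     \<mu> > 0 \<and> (\<forall>x. h differentiable (at x)) \<and>
     (\<exists>x\<^sub>0. global_minimizer h x\<^sub>0 \<and> (\<forall>x. 2 * \<mu> * (h x - h x\<^sub>0) \<le> (norm (grad h x))\<^sup>2))"

text \<open>The agents are the elements of the finite type \<open>'n\<close>, so the number of agents is
  \<open>CARD('n)\<close>. The communication graph is given by its adjacency relation. Self-loops are not
  excluded, since only pairs of distinct agents are ever looked up in \<open>E\<close>.\<close>

definition connected_graph :: "('n \<times> 'n) set \<Rightarrow> bool" where
  "connected_graph E \<longleftrightarrow> sym E \<and> (\<forall>i j. (i, j) \<in> E\<^sup>*)"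

definition doubly_stochastic :: "real^'n^'n \<Rightarrow> bool" where
  "doubly_stochastic W \<longleftrightarrow>
     (\<forall>i j. W $ i $ j \<ge> 0) \<and> (\<forall>i. (\<Sum>j\<in>UNIV. W $ i $ j) = 1) \<and>
     (\<forall>j. (\<Sum>i\<in>UNIV. W $ i $ j) = 1)"

definition consensus_matrix :: "('n \<times> 'n) set \<Rightarrow> real^'n^'n \<Rightarrow> bool" where
  "consensus_matrix E W \<longleftrightarrow>
     doubly_stochastic W \<and> (\<forall>i. W $ i $ i > 0) \<and>
     (\<forall>i j. i \<noteq> j \<longrightarrow> (W $ i $ j > 0 \<longleftrightarrow> (i, j) \<in> E))"

definition spectral_norm :: "real^'n^'m \<Rightarrow> real" where
  "spectral_norm A = onorm (\<lambda>v. A *v v)"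

definition mixing_rate :: "real^'n^'n \<Rightarrow> real" where
  "mixing_rate W = spectral_norm (W - (\<chi> i j. 1 / real CARD('n)))"

definition avg :: "('n::finite \<Rightarrow> 'a::real_vector) \<Rightarrow> 'a" where
  "avg v = (1 / real CARD('n)) *\<^sub>R (\<Sum>i\<in>UNIV. v i)"

definition global_objective :: "('n::finite \<Rightarrow> 'a \<Rightarrow> real) \<Rightarrow> 'a \<Rightarrow> real" where
  "global_objective f x = avg (\<lambda>i. f i x)"

definition grad_est_2d :: "(real^'d \<Rightarrow> real) \<Rightarrow> real^'d \<Rightarrow> real \<Rightarrow> real^'d" where
  "grad_est_2d h x u =
     (\<Sum>k\<in>UNIV. ((h (x + u *\<^sub>R axis k 1) - h (x - u *\<^sub>R axis k 1)) / (2 * u)) *\<^sub>R axis k 1)"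

text \<open>\<open>x t i\<close> and \<open>s t i\<close> are the iterates of agent \<open>i\<close> at time \<open>t\<close>; the initial points
  \<open>x 0 i\<close> are arbitrary, and the radii \<open>u t\<close> are only used for \<open>t \<ge> 1\<close>.\<close>

definition gradient_tracking_run ::
  "real^'n^'n \<Rightarrow> ('n \<Rightarrow> real^'d \<Rightarrow> real) \<Rightarrow> real \<Rightarrow> (nat \<Rightarrow> real) \<Rightarrow>
   (nat \<Rightarrow> 'n \<Rightarrow> real^'d) \<Rightarrow> (nat \<Rightarrow> 'n \<Rightarrow> real^'d) \<Rightarrow> bool" where
  "gradient_tracking_run W f \<eta> u x s \<longleftrightarrow>
     (\<exists>g. (\<forall>i. s 0 i = 0) \<and> (\<forall>i. g 0 i = 0) \<and>
       (\<forall>t\<ge>1. \<forall>i.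
          g t i = grad_est_2d (f i) (x (t - 1) i) (u t) \<and>
          s t i = (\<Sum>j\<in>UNIV. W $ i $ j *\<^sub>R (s (t - 1) j + g t j - g (t - 1) j)) \<and>
          x t i = (\<Sum>j\<in>UNIV. W $ i $ j *\<^sub>R (x (t - 1) j - \<eta> *\<^sub>R s t j))))"

end

theory Submission
  imports Defs
begin

text \<open>
  Write \<open>\<gamma> = 1 - \<rho>\<^sup>2\<close> and call the mean squared distance of a family of vectors to its average its
  dispersion. Multiplication by \<open>W\<close> preserves averages and shrinks dispersions by \<open>\<rho>\<^sup>2\<close>
  (\<open>dispersion_mix_le\<close>). Preservation of averages gives the tracking identity that the average of
  the \<open>s\<^sup>i(t)\<close> is the average of the gradient estimates at time \<open>t\<close>, so the averaged iterate performs
  an inexact gradient step on \<open>f\<close>. Three quantities then control each other: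

  \<^item> the optimality gap \<open>f(avg x(t)) - f(x\<^sup>*)\<close>, which gradient domination contracts by
    \<open>1 - \<eta>\<mu>\<close>, up to \<open>\<eta>L\<^sup>2\<close> times the dispersion of \<open>x\<close> (\<open>averaged_descent\<close>);
  \<^item> the dispersion of \<open>x\<close>, which contracts by \<open>1 - \<gamma>/2\<close> up to \<open>2\<eta>\<^sup>2/\<gamma>\<close> times the dispersion of \<open>s\<close>
    (\<open>dispersion_x_Suc\<close>);
  \<^item> the dispersion of \<open>s\<close>, which contracts by \<open>1 - \<gamma>/2\<close> up to the change of the estimates, that
    is, up to the dispersions of \<open>x\<close> and the squared length of the averaged step (\<open>dispersion_s_Suc\<close>).

  The radii enter through the estimator error \<open>L\<^sup>2 d u\<^sup>2/4\<close>, which comes from the quadratic bound for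
  smooth functions (\<open>grad_est_2d_error\<close>).

  The weighted sum \<open>V(t)\<close> of the gap, \<open>10 L \<gamma>\<close> times the dispersion of \<open>x(t)\<close> and \<open>4 \<eta> \<gamma>\<close> times the
  dispersion of \<open>s(t+1)\<close> absorbs all couplings: the negative term that the descent inequality
  has in the squared averaged step pays for that term in the third recursion, and \<open>\<eta>L \<le> \<gamma>\<^sup>2/14\<close>
  makes the rest small. Hence \<open>V(t+1) \<le> \<lambda> V(t) + (65/4) \<eta> L\<^sup>2 d u(t+1)\<^sup>2\<close>
  (\<open>lyapunov_contraction\<close>), because the prescribed step size gives both \<open>1 - \<lambda> \<le> \<eta>\<mu>\<close> and
  \<open>1 - \<lambda> \<le> \<gamma>\<^sup>2/25\<close>. Unrolling this recursion bounds \<open>V\<close>, and each of the three estimates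
  follows on dividing by the weight of the quantity in question. The weights have their orders
  \<open>L \<gamma>\<close> and \<open>\<eta> \<gamma>\<close> because the noise \<open>\<eta> L\<^sup>2 d u\<^sup>2\<close> divided by them has the claimed
  orders \<open>\<eta> L d u\<^sup>2/\<gamma>\<close> and \<open>L\<^sup>2 d u\<^sup>2/\<gamma>\<close>.

  Two further facts are used. First, \<open>\<mu> \<le> L\<close>: for nonconstant \<open>f\<close> this is a comparison of gradient
  domination with the reverse inequality for smooth functions
  (\<open>gradient_dominated_le_smooth\<close>). Second, \<open>\<rho> < 1\<close>: a doubly stochastic matrix is
  nonexpansive, so \<open>\<rho> \<le> 1\<close>, and \<open>\<rho> = 1\<close> would make the prescribed step size vanish.
\<close>

section \<open>Smooth functions and the difference estimator\<close>

lemma smooth_GDERIV: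
  assumes "smooth L h"
  shows "GDERIV h x :> grad h x"
  using assms by (auto simp: smooth_def intro: GDERIV_grad)

lemma grad_eqI:
  fixes h :: "'a::euclidean_space \<Rightarrow> real"
  assumes "GDERIV h x :> D"
  shows "grad h x = D"
proof -
  have "h differentiable (at x)"
    using assms by (auto simp: gderiv_def differentiable_def)
  from GDERIV_grad[OF this] assms
  have "(\<lambda>v. inner v (grad h x)) = (\<lambda>v. inner v D)"
    unfolding gderiv_def by (rule has_derivative_unique)
  then show ?thesis
    by (metis vector_eq_ldot)
qed

text \<open>Along the segment from \<open>x\<close> to \<open>y\<close> the linearization error has derivative at most
  \<open>L t \<parallel>y - x\<parallel>\<^sup>2\<close> at time \<open>t\<close>, the derivative of \<open>L t\<^sup>2 \<parallel>y - x\<parallel>\<^sup>2 / 2\<close>; the sign \<open>\<sigma>\<close> in the proof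
  gives both directions at once.\<close>

lemma smooth_quadratic_bound:
  fixes h :: "'a::euclidean_space \<Rightarrow> real"
  assumes "smooth L h"
  shows "\<bar>h y - h x - inner (grad h x) (y - x)\<bar> \<le> L / 2 * (norm (y - x))\<^sup>2"
proof -
  define v where "v = y - x"
  have bound: "\<sigma> * (h y - h x - inner (grad h x) v) \<le> L / 2 * (norm v)\<^sup>2"
    if \<sigma>: "\<bar>\<sigma>\<bar> = 1" for \<sigma> :: real
  proof -
    define \<phi> where
      "\<phi> t = \<sigma> * (h (x + t *\<^sub>R v) - t * inner (grad h x) v) - L / 2 * t\<^sup>2 * (norm v)\<^sup>2" for t
    have deriv: "(\<phi> has_real_derivative
        \<sigma> * inner (grad h (x + t *\<^sub>R v) - grad h x) v - L * t * (norm v)\<^sup>2) (at t)" for t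
    proof -
      have "((\<lambda>t. x + t *\<^sub>R v) has_derivative (\<lambda>s. s *\<^sub>R v)) (at t)"
        by (auto intro!: derivative_eq_intros)
      from has_derivative_compose[OF this
          smooth_GDERIV[OF assms, of "x + t *\<^sub>R v", unfolded gderiv_def]]
      have 1: "((\<lambda>t. h (x + t *\<^sub>R v)) has_real_derivative inner (grad h (x + t *\<^sub>R v)) v) (at t)"
        unfolding has_field_derivative_def
        by (rule has_derivative_eq_rhs) (simp add: fun_eq_iff inner_commute mult.commute)
      show ?thesis
        unfolding \<phi>_def
        by (rule derivative_eq_intros 1 refl | simp add: inner_diff_left algebra_simps)+
    qed
    have "\<phi> 1 \<le> \<phi> 0"
    proof (rule DERIV_nonpos_imp_nonincreasing[where f = \<phi>])
      fix t :: real
      assume t: "0 \<le> t" "t \<le> 1"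
      have "\<sigma> * inner (grad h (x + t *\<^sub>R v) - grad h x) v
          \<le> \<bar>inner (grad h (x + t *\<^sub>R v) - grad h x) v\<bar>"
        using \<sigma> by (metis abs_ge_self abs_mult mult_1)
      also have "\<dots> \<le> norm (grad h (x + t *\<^sub>R v) - grad h x) * norm v"
        by (rule Cauchy_Schwarz_ineq2)
      also have "\<dots> \<le> (L * norm (x + t *\<^sub>R v - x)) * norm v"
        using assms unfolding smooth_def by (intro mult_right_mono) (blast, simp)
      also have "\<dots> = L * t * (norm v)\<^sup>2"
        using t by (simp add: power2_eq_square)
      finally show "\<exists>z. (\<phi> has_real_derivative z) (at t) \<and> z \<le> 0"
        using deriv by fastforce
    qed simp
    then show ?thesis
      by (simp add: \<phi>_def v_def algebra_simps)
  qed
  show ?thesis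
    using bound[of 1, simplified] bound[of "-1", simplified] unfolding v_def[symmetric] by linarith
qed

text \<open>One gradient step of length \<open>1 / L\<close> already decreases \<open>h\<close> by \<open>\<parallel>grad h x\<parallel>\<^sup>2 / (2 L)\<close>, and \<open>h\<close> cannot fall
  below its minimum.\<close>

lemma smooth_norm_grad_le:
  fixes h :: "'a::euclidean_space \<Rightarrow> real"
  assumes "smooth L h" "L > 0" "global_minimizer h x\<^sub>0"
  shows "(norm (grad h x))\<^sup>2 \<le> 2 * L * (h x - h x\<^sub>0)"
proof -
  define y where "y = x - (1 / L) *\<^sub>R grad h x"
  have "h x\<^sub>0 \<le> h y"
    using assms(3) by (simp add: global_minimizer_def)
  also have "h y \<le> h x + inner (grad h x) (y - x) + L / 2 * (norm (y - x))\<^sup>2"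
    using smooth_quadratic_bound[OF assms(1), of y x] by linarith
  also have "\<dots> = h x - (norm (grad h x))\<^sup>2 / (2 * L)"
    using \<open>L > 0\<close> by (simp add: y_def power2_norm_eq_inner power_mult_distrib field_simps)
       (simp add: power2_eq_square dot_square_norm)
  finally show ?thesis
    using \<open>L > 0\<close> by (simp add: field_simps)
qed

lemma gradient_dominated_le_smooth:
  fixes h :: "'a::euclidean_space \<Rightarrow> real"
  assumes "smooth L h" "L > 0" "gradient_dominated \<mu> h" "h x \<noteq> h y"
  shows "\<mu> \<le> L"
proof -
  obtain x\<^sub>0 where x0: "global_minimizer h x\<^sub>0"
      "\<And>x. 2 * \<mu> * (h x - h x\<^sub>0) \<le> (norm (grad h x))\<^sup>2"
    using assms(3) by (auto simp: gradient_dominated_def)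
  obtain z where "h z > h x\<^sub>0"
    using x0(1) assms(4) unfolding global_minimizer_def by (metis less_eq_real_def)
  moreover have "2 * \<mu> * (h z - h x\<^sub>0) \<le> 2 * L * (h z - h x\<^sub>0)"
    using x0 smooth_norm_grad_le[OF assms(1,2) x0(1)] order_trans by blast
  ultimately show ?thesis
    by simp
qed

text \<open>In a central difference the value \<open>h x\<close> cancels, so the two quadratic remainders \<open>L u\<^sup>2 / 2\<close> divided
  by \<open>2 u\<close> leave an error of at most \<open>L u / 2\<close> in each of the \<open>d\<close> coordinates.\<close>

lemma grad_est_2d_error:
  fixes h :: "real^'d \<Rightarrow> real"
  assumes "smooth L h" "u > 0"
  shows "(norm (grad_est_2d h x u - grad h x))\<^sup>2 \<le> real CARD('d) * (L * u / 2)\<^sup>2"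
proof -
  define e where "e = grad_est_2d h x u - grad h x"
  have comp: "(e $ k)\<^sup>2 \<le> (L * u / 2)\<^sup>2" for k
  proof -
    let ?a = "axis k 1 :: real^'d"
    have "e $ k = (h (x + u *\<^sub>R ?a) - h (x - u *\<^sub>R ?a)) / (2 * u) - grad h x $ k"
      by (simp add: e_def grad_est_2d_def axis_def if_distrib sum.delta cong: if_cong)
    moreover have "\<bar>h (x + u *\<^sub>R ?a) - h x - u * grad h x $ k\<bar> \<le> L / 2 * u\<^sup>2"
      using smooth_quadratic_bound[OF assms(1), of "x + u *\<^sub>R ?a" x]
      by (simp add: inner_axis)
    moreover have "\<bar>h (x - u *\<^sub>R ?a) - h x + u * grad h x $ k\<bar> \<le> L / 2 * u\<^sup>2"
      using smooth_quadratic_bound[OF assms(1), of "x - u *\<^sub>R ?a" x]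
      by (simp add: inner_axis)
    ultimately have "\<bar>e $ k\<bar> * (2 * u) \<le> L * u\<^sup>2"
      using \<open>u > 0\<close> by (simp add: abs_if field_simps split: if_splits)
    then have "\<bar>e $ k\<bar> \<le> L * u / 2"
      using \<open>u > 0\<close> by (simp add: power2_eq_square field_simps)
    then show ?thesis
      by (metis abs_ge_zero power2_abs power_mono)
  qed
  have "(norm e)\<^sup>2 = (\<Sum>k\<in>UNIV. (e $ k)\<^sup>2)"
    by (simp add: norm_vec_def L2_set_def sum_nonneg)
  also have "\<dots> \<le> (\<Sum>k\<in>(UNIV :: 'd set). (L * u / 2)\<^sup>2)"
    by (intro sum_mono comp)
  finally show ?thesis
    by (simp add: e_def)
qed

section \<open>Averages and dispersion over the agents\<close>

definition mean_sq :: "('n::finite \<Rightarrow> 'a::real_normed_vector) \<Rightarrow> real" where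
  "mean_sq v = avg (\<lambda>i. (norm (v i))\<^sup>2)"

definition dispersion :: "('n::finite \<Rightarrow> 'a::real_normed_vector) \<Rightarrow> real" where
  "dispersion v = mean_sq (\<lambda>i. v i - avg v)"

lemma avg_add: "avg (\<lambda>i. v i + w i) = avg v + avg w"
  by (simp add: avg_def sum.distrib scaleR_add_right)

lemma avg_diff: "avg (\<lambda>i. v i - w i) = avg v - avg w"
  by (simp add: avg_def sum_subtractf scaleR_diff_right)

lemma avg_scaleR: "avg (\<lambda>i. c *\<^sub>R v i) = c *\<^sub>R avg v"
  by (simp add: avg_def scaleR_sum_right[symmetric])

lemma avg_mult: "avg (\<lambda>i. c * v i) = c * avg v" for v :: "'n::finite \<Rightarrow> real"
  using avg_scaleR[of c v] by simp

lemma avg_const [simp]: "avg (\<lambda>i::'n::finite. c) = (c :: 'a::real_vector)"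
  by (simp add: avg_def sum_constant_scaleR)

lemma avg_real: "avg v = 1 / real CARD('n) * (\<Sum>i\<in>UNIV. v i)"
  for v :: "'n::finite \<Rightarrow> real"
  by (simp add: avg_def)

lemma avg_mono: "(\<And>i. v i \<le> w i) \<Longrightarrow> avg v \<le> avg w"
  for v :: "'n::finite \<Rightarrow> real"
  by (simp add: avg_def divide_right_mono sum_mono)

lemma mean_sq_nonneg: "0 \<le> mean_sq v"
  by (simp add: mean_sq_def avg_def sum_nonneg)

lemma dispersion_nonneg: "0 \<le> dispersion v"
  by (simp add: dispersion_def mean_sq_nonneg)

lemma norm_avg_le: "norm (avg v) \<le> avg (\<lambda>i. norm (v i))"
  by (simp add: avg_def divide_right_mono norm_sum)

text \<open>The bias-variance decomposition: deviations from the average are orthogonal, on average, to any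
  fixed vector. It also shows that the average minimizes the mean squared distance.\<close>

lemma mean_sq_shift:
  fixes v :: "'n::finite \<Rightarrow> 'a::euclidean_space"
  shows "mean_sq (\<lambda>i. v i - c) = dispersion v + (norm (avg v - c))\<^sup>2"
proof -
  have "(norm (v i - c))\<^sup>2 = (norm (v i - avg v))\<^sup>2
      + (2 * inner (v i - avg v) (avg v - c) + (norm (avg v - c))\<^sup>2)" for i
    by (simp add: power2_norm_eq_inner inner_diff inner_commute algebra_simps)
  moreover have "avg (\<lambda>i. inner (v i - avg v) (avg v - c)) = inner (avg (\<lambda>i. v i - avg v)) (avg v - c)"
    by (simp add: avg_def inner_sum_left)
  ultimately show ?thesis
    by (simp add: mean_sq_def dispersion_def avg_add avg_mult avg_diff)
qed

lemma dispersion_le_mean_sq: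
  fixes v :: "'n::finite \<Rightarrow> 'a::euclidean_space"
  shows "dispersion v \<le> mean_sq v"
  using mean_sq_shift[of v 0] by simp

lemma norm_avg_sq_le:
  fixes v :: "'n::finite \<Rightarrow> 'a::euclidean_space"
  shows "(norm (avg v))\<^sup>2 \<le> mean_sq v"
  using mean_sq_shift[of v 0] dispersion_nonneg[of v] by simp

text \<open>Young's inequality. The choice of \<open>\<theta>\<close> trades the contraction factor of one term against the
  amplification of the other: \<open>\<theta> = \<gamma> / 2\<close> below keeps a contraction, and \<open>\<theta> = 1\<close> gives the usual
  factor 2 wherever no contraction is at stake.\<close>

lemma norm_add_sq_le:
  fixes p q :: "'a::real_inner"
  assumes "\<theta> > 0"
  shows "(norm (p + q))\<^sup>2 \<le> (1 + \<theta>) * (norm p)\<^sup>2 + (1 + 1 / \<theta>) * (norm q)\<^sup>2"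
proof -
  have "0 \<le> (norm (\<theta> *\<^sub>R p - q))\<^sup>2"
    by simp
  also have "\<dots> = \<theta>\<^sup>2 * (norm p)\<^sup>2 - 2 * \<theta> * inner p q + (norm q)\<^sup>2"
    by (simp add: power2_norm_eq_inner inner_diff inner_commute[of q p] algebra_simps)
       (simp add: power2_eq_square)
  finally have "2 * inner p q \<le> (\<theta>\<^sup>2 * (norm p)\<^sup>2 + (norm q)\<^sup>2) / \<theta>"
    using assms by (simp add: pos_le_divide_eq algebra_simps)
  also have "\<dots> = \<theta> * (norm p)\<^sup>2 + (norm q)\<^sup>2 / \<theta>"
    using assms by (simp add: add_divide_distrib power2_eq_square)
  finally have "2 * inner p q \<le> \<theta> * (norm p)\<^sup>2 + (norm q)\<^sup>2 / \<theta>" .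
  moreover have "(norm (p + q))\<^sup>2 = (norm p)\<^sup>2 + 2 * inner p q + (norm q)\<^sup>2"
    by (simp add: power2_norm_eq_inner inner_add inner_commute)
  ultimately show ?thesis
    by (simp add: algebra_simps)
qed

lemma mean_sq_add_le:
  fixes v w :: "'n::finite \<Rightarrow> 'a::euclidean_space"
  assumes "\<theta> > 0"
  shows "mean_sq (\<lambda>i. v i + w i) \<le> (1 + \<theta>) * mean_sq v + (1 + 1 / \<theta>) * mean_sq w"
proof -
  have "mean_sq (\<lambda>i. v i + w i) \<le> avg (\<lambda>i. (1 + \<theta>) * (norm (v i))\<^sup>2 + (1 + 1 / \<theta>) * (norm (w i))\<^sup>2)"
    unfolding mean_sq_def by (intro avg_mono norm_add_sq_le assms)
  then show ?thesis
    by (simp add: mean_sq_def avg_add avg_mult)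
qed

lemma dispersion_add_le:
  fixes v w :: "'n::finite \<Rightarrow> 'a::euclidean_space"
  assumes "\<theta> > 0"
  shows "dispersion (\<lambda>i. v i + w i) \<le> (1 + \<theta>) * dispersion v + (1 + 1 / \<theta>) * dispersion w"
  using mean_sq_add_le[OF assms, of "\<lambda>i. v i - avg v" "\<lambda>i. w i - avg w"]
  by (simp add: dispersion_def avg_add algebra_simps)

lemma dispersion_scaleR: "dispersion (\<lambda>i. c *\<^sub>R v i) = c\<^sup>2 * dispersion v"
  by (simp add: dispersion_def mean_sq_def avg_scaleR scaleR_diff_right[symmetric]
      power_mult_distrib avg_mult)

section \<open>The averaged objective\<close>

lemma global_objective_GDERIV:
  fixes f :: "'n::finite \<Rightarrow> 'a::euclidean_space \<Rightarrow> real"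
  assumes "\<forall>i. smooth L (f i)"
  shows "GDERIV (global_objective f) x :> avg (\<lambda>i. grad (f i) x)"
proof -
  have "((\<lambda>x. (1 / real CARD('n)) *\<^sub>R (\<Sum>i\<in>UNIV. f i x)) has_derivative
      (\<lambda>v. (1 / real CARD('n)) *\<^sub>R (\<Sum>i\<in>UNIV. inner v (grad (f i) x)))) (at x)"
    using smooth_GDERIV[OF assms[rule_format]] unfolding gderiv_def
    by (intro has_derivative_scaleR_right has_derivative_sum) auto
  moreover have "(\<lambda>v. (1 / real CARD('n)) *\<^sub>R (\<Sum>i\<in>UNIV. inner v (grad (f i) x)))
      = (\<lambda>v. inner v (avg (\<lambda>i. grad (f i) x)))"
    by (simp add: avg_def inner_sum_right)
  ultimately show ?thesis
    by (simp add: gderiv_def global_objective_def[abs_def] avg_def)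
qed

lemma grad_global_objective:
  fixes f :: "'n::finite \<Rightarrow> 'a::euclidean_space \<Rightarrow> real"
  assumes "\<forall>i. smooth L (f i)"
  shows "grad (global_objective f) x = avg (\<lambda>i. grad (f i) x)"
  by (rule grad_eqI[OF global_objective_GDERIV[OF assms]])

lemma smooth_global_objective:
  fixes f :: "'n::finite \<Rightarrow> 'a::euclidean_space \<Rightarrow> real"
  assumes "\<forall>i. smooth L (f i)"
  shows "smooth L (global_objective f)"
  unfolding smooth_def
proof (intro conjI allI)
  show "global_objective f differentiable (at x)" for x
    using global_objective_GDERIV[OF assms, where x = x] by (auto simp: gderiv_def differentiable_def)
  have "continuous_on UNIV (\<lambda>x. (1 / real CARD('n)) *\<^sub>R (\<Sum>i\<in>UNIV. grad (f i) x))"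
    using assms unfolding smooth_def by (intro continuous_intros) auto
  then show "continuous_on UNIV (grad (global_objective f))"
    by (simp add: grad_global_objective[OF assms, abs_def] avg_def)
  show "norm (grad (global_objective f) x - grad (global_objective f) y) \<le> L * norm (x - y)" for x y
  proof -
    have "grad (global_objective f) x - grad (global_objective f) y
        = avg (\<lambda>i. grad (f i) x - grad (f i) y)"
      by (simp add: grad_global_objective[OF assms] avg_diff)
    also have "norm \<dots> \<le> avg (\<lambda>i::'n. L * norm (x - y))"
      using assms unfolding smooth_def by (intro order_trans[OF norm_avg_le] avg_mono) auto
    finally show ?thesis
      by simp
  qed
qed

section \<open>Mixing with a doubly stochastic matrix\<close>

definition mix :: "real^'n^'n \<Rightarrow> ('n::finite \<Rightarrow> 'a::real_vector) \<Rightarrow> 'n \<Rightarrow> 'a" where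
  "mix W v i = (\<Sum>j\<in>UNIV. W $ i $ j *\<^sub>R v j)"

lemma avg_mix:
  assumes "doubly_stochastic W"
  shows "avg (mix W v) = avg v"
proof -
  have "(\<Sum>i\<in>UNIV. mix W v i) = (\<Sum>j\<in>UNIV. (\<Sum>i\<in>UNIV. W $ i $ j) *\<^sub>R v j)"
    unfolding mix_def by (subst sum.swap) (simp add: scaleR_sum_left)
  then show ?thesis
    using assms by (simp add: avg_def doubly_stochastic_def)
qed

text \<open>Unit row sums make each entry of \<open>W v\<close> a convex combination of the entries of \<open>v\<close>, to which Jensen's
  inequality for the square applies; summing over the rows, the column sums are again 1.\<close>

lemma doubly_stochastic_norm_le:
  fixes W :: "real^'n^'n"
  assumes "doubly_stochastic W"
  shows "norm (W *v v) \<le> norm v"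
proof -
  have row: "((W *v v) $ i)\<^sup>2 \<le> (\<Sum>j\<in>UNIV. W $ i $ j * (v $ j)\<^sup>2)" for i
  proof -
    define m where "m = (W *v v) $ i"
    have m: "(\<Sum>j\<in>UNIV. W $ i $ j * v $ j) = m"
      by (simp add: m_def matrix_vector_mult_def)
    have "0 \<le> (\<Sum>j\<in>UNIV. W $ i $ j * (v $ j - m)\<^sup>2)"
      using assms by (intro sum_nonneg mult_nonneg_nonneg) (auto simp: doubly_stochastic_def)
    also have "\<dots> = (\<Sum>j\<in>UNIV. W $ i $ j * (v $ j)\<^sup>2 - 2 * m * (W $ i $ j * v $ j) + m\<^sup>2 * W $ i $ j)"
      by (simp add: power2_eq_square algebra_simps)
    also have "\<dots> = (\<Sum>j\<in>UNIV. W $ i $ j * (v $ j)\<^sup>2) - 2 * m * m + m\<^sup>2 * (\<Sum>j\<in>UNIV. W $ i $ j)"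
      by (simp add: sum.distrib sum_subtractf sum_distrib_left[symmetric] m)
    also have "(\<Sum>j\<in>UNIV. W $ i $ j) = 1"
      using assms by (simp add: doubly_stochastic_def)
    finally show ?thesis
      by (simp add: m_def power2_eq_square)
  qed
  have "(norm (W *v v))\<^sup>2 = (\<Sum>i\<in>UNIV. ((W *v v) $ i)\<^sup>2)"
    by (simp add: norm_vec_def L2_set_def sum_nonneg)
  also have "\<dots> \<le> (\<Sum>i\<in>UNIV. \<Sum>j\<in>UNIV. W $ i $ j * (v $ j)\<^sup>2)"
    by (intro sum_mono row)
  also have "\<dots> = (\<Sum>j\<in>UNIV. (\<Sum>i\<in>UNIV. W $ i $ j) * (v $ j)\<^sup>2)"
    by (subst sum.swap) (simp add: sum_distrib_right)
  also have "\<dots> = (norm v)\<^sup>2"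
    using assms by (simp add: doubly_stochastic_def norm_vec_def L2_set_def sum_nonneg)
  finally show ?thesis
    by (simp add: power2_le_iff_abs_le)
qed

lemma averaging_matrix_mult:
  fixes W :: "real^'n^'n"
  shows "((W - (\<chi> i j. 1 / real CARD('n))) *v v) $ i = (W *v v) $ i - avg (\<lambda>j. v $ j)"
  by (simp add: matrix_vector_mult_def avg_def left_diff_distrib sum_subtractf sum_divide_distrib)

lemma mixing_rate_nonneg: "0 \<le> mixing_rate W"
  unfolding mixing_rate_def spectral_norm_def by (intro onorm_pos_le matrix_vector_mul_bounded_linear)

text \<open>Subtracting the averaging matrix amounts to centering the argument before applying \<open>W\<close>, and both
  centering and \<open>W\<close> are nonexpansive.\<close>

lemma mixing_rate_le_1:
  fixes W :: "real^'n^'n"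
  assumes "doubly_stochastic W"
  shows "mixing_rate W \<le> 1"
  unfolding mixing_rate_def spectral_norm_def
proof (rule onorm_le)
  fix v :: "real^'n"
  let ?J = "(\<chi> i j. 1 / real CARD('n)) :: real^'n^'n"
  define w where "w = (\<chi> j. v $ j - avg (\<lambda>j. v $ j))"
  have "(W - ?J) *v v = W *v w"
    using assms
    by (simp add: vec_eq_iff averaging_matrix_mult)
       (simp add: matrix_vector_mult_def w_def right_diff_distrib sum_subtractf
          sum_distrib_right[symmetric] doubly_stochastic_def)
  then have "norm ((W - ?J) *v v) \<le> norm w"
    using doubly_stochastic_norm_le[OF assms, of w] by simp
  also have "(norm w)\<^sup>2 \<le> (norm v)\<^sup>2"
    using dispersion_le_mean_sq[of "\<lambda>j. v $ j"]
    by (simp add: w_def norm_vec_def L2_set_def sum_nonneg dispersion_def mean_sq_def avg_def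
        divide_le_cancel)
  then have "norm w \<le> norm v"
    by (simp add: power2_le_iff_abs_le)
  finally show "norm ((W - ?J) *v v) \<le> 1 * norm v"
    by simp
qed

text \<open>For a fixed basis vector \<open>b\<close>, the coordinates of the centered family form a vector \<open>z b\<close> over the agents
  with average zero, on which \<open>W\<close> agrees with \<open>W\<close> minus the averaging matrix. The spectral norm
  thus bounds each coordinate, and Parseval's identity reassembles them.\<close>

lemma dispersion_mix_le:
  fixes W :: "real^'n^'n" and v :: "'n \<Rightarrow> 'a::euclidean_space"
  assumes "doubly_stochastic W"
  shows "dispersion (mix W v) \<le> (mixing_rate W)\<^sup>2 * dispersion v"
proof -
  let ?J = "(\<chi> i j. 1 / real CARD('n)) :: real^'n^'n"
  define z where "z b = (\<chi> j. inner (v j - avg v) b)" for b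
  have z: "((W - ?J) *v z b) $ i = inner (mix W v i - avg (mix W v)) b" for b i
  proof -
    have "avg (\<lambda>j. z b $ j) = inner (avg (\<lambda>j. v j - avg v)) b"
      by (simp add: z_def avg_def inner_sum_left)
    then have "avg (\<lambda>j. z b $ j) = 0"
      by (simp add: avg_diff)
    moreover have "(W *v z b) $ i = inner (\<Sum>j\<in>UNIV. W $ i $ j *\<^sub>R (v j - avg v)) b"
      by (simp add: matrix_vector_mult_def z_def inner_sum_left)
    moreover have "(\<Sum>j\<in>UNIV. W $ i $ j *\<^sub>R (v j - avg v)) = mix W v i - avg v"
      using assms by (simp add: mix_def scaleR_diff_right sum_subtractf scaleR_sum_left[symmetric]
          doubly_stochastic_def)
    ultimately show ?thesis
      by (simp add: averaging_matrix_mult avg_mix[OF assms])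
  qed
  have parseval: "(\<Sum>i\<in>UNIV. (norm (y i))\<^sup>2) = (\<Sum>b\<in>Basis. \<Sum>i\<in>UNIV. (inner (y i) b)\<^sup>2)"
    for y :: "'n \<Rightarrow> 'a"
  proof -
    have "(norm (y i))\<^sup>2 = (\<Sum>b\<in>Basis. (inner (y i) b)\<^sup>2)" for i
      using euclidean_inner[of "y i" "y i"] by (simp add: dot_square_norm power2_eq_square)
    then show ?thesis
      by (subst sum.swap) simp
  qed
  have nz: "(norm (y :: real^'n))\<^sup>2 = (\<Sum>i\<in>UNIV. (y $ i)\<^sup>2)" for y
    by (simp add: norm_vec_def L2_set_def sum_nonneg)
  have "(\<Sum>i\<in>UNIV. (norm (mix W v i - avg (mix W v)))\<^sup>2) = (\<Sum>b\<in>Basis. (norm ((W - ?J) *v z b))\<^sup>2)"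
    by (simp add: parseval nz z)
  also have "\<dots> \<le> (\<Sum>b\<in>Basis. (mixing_rate W * norm (z b))\<^sup>2)"
    unfolding mixing_rate_def spectral_norm_def
    by (intro sum_mono power_mono onorm matrix_vector_mul_bounded_linear) auto
  also have "\<dots> = (mixing_rate W)\<^sup>2 * (\<Sum>i\<in>UNIV. (norm (v i - avg v))\<^sup>2)"
    by (simp add: parseval power_mult_distrib sum_distrib_left[symmetric] nz z_def)
  finally show ?thesis
    by (simp add: dispersion_def mean_sq_def avg_def divide_right_mono)
qed

text \<open>Young's inequality with \<open>\<theta> = \<gamma> / 2\<close> spends half of the contraction \<open>1 - \<gamma>\<close> of one mixing step on the
  cross term, since \<open>(1 - \<gamma>) (1 + \<gamma> / 2) \<le> 1 - \<gamma> / 2\<close>.\<close>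

lemma dispersion_mix_add_le:
  fixes W :: "real^'n^'n" and v w :: "'n \<Rightarrow> 'a::euclidean_space"
  assumes "doubly_stochastic W" and \<gamma>: "\<gamma> = 1 - (mixing_rate W)\<^sup>2" "\<gamma> > 0"
  shows "dispersion (mix W (\<lambda>i. v i + w i)) \<le> (1 - \<gamma> / 2) * dispersion v + 2 / \<gamma> * dispersion w"
proof -
  have \<gamma>1: "\<gamma> \<le> 1"
    using \<gamma> by simp
  have "dispersion (mix W (\<lambda>i. v i + w i)) \<le> (1 - \<gamma>) * dispersion (\<lambda>i. v i + w i)"
    using dispersion_mix_le[OF assms(1)] \<gamma> by simp
  also have "\<dots> \<le> (1 - \<gamma>) * ((1 + \<gamma> / 2) * dispersion v + (1 + 1 / (\<gamma> / 2)) * dispersion w)"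
    using \<gamma>1 \<gamma>(2) by (intro mult_left_mono dispersion_add_le) auto
  also have "\<dots> = ((1 - \<gamma>) * (1 + \<gamma> / 2)) * dispersion v + ((1 - \<gamma>) * (1 + 2 / \<gamma>)) * dispersion w"
    by (simp add: algebra_simps)
  also have "\<dots> \<le> (1 - \<gamma> / 2) * dispersion v + 2 / \<gamma> * dispersion w"
    using \<gamma>(2) \<gamma>1 by (intro add_mono mult_right_mono dispersion_nonneg) (auto simp: field_simps)
  finally show ?thesis .
qed

section \<open>Gradient tracking\<close>

text \<open>The estimates \<open>g\<close>, which are existentially bound in \<open>gradient_tracking_run\<close>, are named here, and each
  update is written as mixing a sum of two families, the form to which \<open>dispersion_mix_add_le\<close>
  applies.\<close>

locale gradient_tracking =
  fixes W :: "real^'n^'n" and f :: "'n \<Rightarrow> real^'d \<Rightarrow> real" and L \<eta> \<gamma> :: real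
    and u :: "nat \<Rightarrow> real" and x s g :: "nat \<Rightarrow> 'n \<Rightarrow> real^'d"
  assumes ds: "doubly_stochastic W"
    and spectral_gap: "\<gamma> = 1 - (mixing_rate W)\<^sup>2" "\<gamma> > 0"
    and smooth: "\<forall>i. smooth L (f i)"
    and \<eta>_pos: "\<eta> > 0"
    and u_pos: "u (Suc t) > 0" and u_decreasing: "u (Suc (Suc t)) \<le> u (Suc t)"
    and initial: "s 0 i = 0" "g 0 i = 0"
    and g_Suc: "g (Suc t) i = grad_est_2d (f i) (x t i) (u (Suc t))"
    and s_Suc: "s (Suc t) = mix W (\<lambda>i. s t i + (g (Suc t) i - g t i))"
    and x_Suc: "x (Suc t) = mix W (\<lambda>i. x t i + (- \<eta>) *\<^sub>R s (Suc t) i)"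
begin

abbreviation F :: "real^'d \<Rightarrow> real" where
  "F \<equiv> global_objective f"

text \<open>The identity behind gradient tracking: the increments \<open>g(t) - g(t-1)\<close> telescope in the average, which
  mixing preserves.\<close>

lemma avg_s: "avg (s t) = avg (g t)"
proof (induction t)
  case 0
  then show ?case
    by (simp add: avg_def initial)
next
  case (Suc t)
  then show ?case
    by (simp add: s_Suc avg_mix[OF ds] avg_add avg_diff)
qed

lemma avg_x_Suc: "avg (x (Suc t)) = avg (x t) - \<eta> *\<^sub>R avg (g (Suc t))"
proof -
  have "avg (x (Suc t)) = avg (x t) + (- \<eta>) *\<^sub>R avg (s (Suc t))"
    unfolding x_Suc avg_mix[OF ds] avg_add avg_scaleR ..
  then show ?thesis
    by (simp add: avg_s)
qed

lemma dispersion_x_Suc: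
  "dispersion (x (Suc t)) \<le> (1 - \<gamma> / 2) * dispersion (x t) + 2 / \<gamma> * (\<eta>\<^sup>2 * dispersion (s (Suc t)))"
  using dispersion_mix_add_le[OF ds spectral_gap, of "x t" "\<lambda>i. (- \<eta>) *\<^sub>R s (Suc t) i"]
  unfolding dispersion_scaleR x_Suc[symmetric] by simp

lemma estimator_mean_sq_error:
  "mean_sq (\<lambda>i. g (Suc t) i - grad (f i) (x t i)) \<le> L\<^sup>2 * real CARD('d) * (u (Suc t))\<^sup>2 / 4"
proof -
  have "mean_sq (\<lambda>i. g (Suc t) i - grad (f i) (x t i)) \<le> avg (\<lambda>i::'n. real CARD('d) * (L * u (Suc t) / 2)\<^sup>2)"
    unfolding mean_sq_def g_Suc using smooth u_pos by (intro avg_mono grad_est_2d_error) auto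
  then show ?thesis
    by (simp add: power2_eq_square algebra_simps)
qed

lemma mean_sq_grad_diff_le:
  "mean_sq (\<lambda>i. grad (f i) (v i) - grad (f i) (w i)) \<le> L\<^sup>2 * mean_sq (\<lambda>i. v i - w i)"
proof -
  have "(norm (grad (f i) (v i) - grad (f i) (w i)))\<^sup>2 \<le> L\<^sup>2 * (norm (v i - w i))\<^sup>2" for i
    using smooth unfolding smooth_def power_mult_distrib[symmetric] by (intro power_mono) auto
  then show ?thesis
    unfolding mean_sq_def avg_mult[symmetric] by (rule avg_mono)
qed

text \<open>The averaged estimate deviates from the gradient at the average because the agents evaluate their
  gradients at different points and because these evaluations are inexact; smoothness bounds the
  first deviation by the dispersion of \<open>x\<close>.\<close>

lemma average_gradient_error:
  "(norm (avg (g (Suc t)) - grad F (avg (x t))))\<^sup>2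
     \<le> 2 * L\<^sup>2 * dispersion (x t) + L\<^sup>2 * real CARD('d) * (u (Suc t))\<^sup>2 / 2"
proof -
  let ?e = "\<lambda>i. g (Suc t) i - grad (f i) (x t i)"
  let ?c = "\<lambda>i. grad (f i) (x t i) - grad (f i) (avg (x t))"
  have error: "avg (g (Suc t)) - grad F (avg (x t)) = avg (\<lambda>i. ?c i + ?e i)"
    by (simp add: grad_global_objective[OF smooth] avg_add avg_diff)
  have "(norm (avg (g (Suc t)) - grad F (avg (x t))))\<^sup>2 \<le> mean_sq (\<lambda>i. ?c i + ?e i)"
    unfolding error by (rule norm_avg_sq_le)
  also have "\<dots> \<le> 2 * mean_sq ?c + 2 * mean_sq ?e"
    using mean_sq_add_le[of 1 ?c ?e] by simp
  also have "mean_sq ?c \<le> L\<^sup>2 * dispersion (x t)"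
    unfolding dispersion_def by (rule mean_sq_grad_diff_le)
  also have "mean_sq ?e \<le> L\<^sup>2 * real CARD('d) * (u (Suc t))\<^sup>2 / 4"
    by (rule estimator_mean_sq_error)
  finally show ?thesis
    by (simp add: algebra_simps)
qed

text \<open>The increment splits into its average, which is the averaged gradient step, and its deviation from it,
  which is a difference of two centered families.\<close>

lemma mean_sq_x_increment_le:
  "mean_sq (\<lambda>i. x (Suc t) i - x t i)
     \<le> 2 * dispersion (x (Suc t)) + 2 * dispersion (x t) + \<eta>\<^sup>2 * (norm (avg (g (Suc t))))\<^sup>2"
proof -
  have "dispersion (\<lambda>i. x (Suc t) i - x t i) \<le> 2 * dispersion (x (Suc t)) + 2 * dispersion (x t)"
    using dispersion_add_le[of 1 "x (Suc t)" "\<lambda>i. (- 1) *\<^sub>R x t i"]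
    unfolding dispersion_scaleR by simp
  moreover have "(norm (avg (\<lambda>i. x (Suc t) i - x t i)))\<^sup>2 = \<eta>\<^sup>2 * (norm (avg (g (Suc t))))\<^sup>2"
    by (simp add: avg_diff avg_x_Suc power_mult_distrib)
  ultimately show ?thesis
    using mean_sq_shift[of "\<lambda>i. x (Suc t) i - x t i" 0] by simp
qed

text \<open>Monotonicity of the radii lets the earlier radius \<open>u (Suc t)\<close> bound both estimator errors. This is
  what makes the noise in the recursion from \<open>t\<close> to \<open>t + 1\<close> depend on a single radius.\<close>

lemma mean_sq_g_increment_le:
  "mean_sq (\<lambda>i. g (Suc (Suc t)) i - g (Suc t) i)
     \<le> 2 * L\<^sup>2 * mean_sq (\<lambda>i. x (Suc t) i - x t i) + 2 * L\<^sup>2 * real CARD('d) * (u (Suc t))\<^sup>2"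
proof -
  let ?e = "\<lambda>t i. g (Suc t) i - grad (f i) (x t i)"
  let ?c = "\<lambda>i. grad (f i) (x (Suc t) i) - grad (f i) (x t i)"
  have "mean_sq (\<lambda>i. g (Suc (Suc t)) i - g (Suc t) i)
      = mean_sq (\<lambda>i. ?c i + (?e (Suc t) i + - ?e t i))"
    by (simp add: algebra_simps)
  also have "\<dots> \<le> 2 * mean_sq ?c + 2 * mean_sq (\<lambda>i. ?e (Suc t) i + - ?e t i)"
    using mean_sq_add_le[of 1 ?c "\<lambda>i. ?e (Suc t) i + - ?e t i"] by simp
  also have "mean_sq ?c \<le> L\<^sup>2 * mean_sq (\<lambda>i. x (Suc t) i - x t i)"
    by (rule mean_sq_grad_diff_le)
  also have "mean_sq (\<lambda>i. ?e (Suc t) i + - ?e t i) \<le> 2 * mean_sq (?e (Suc t)) + 2 * mean_sq (?e t)"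
    using mean_sq_add_le[of 1 "?e (Suc t)" "\<lambda>i. - ?e t i"]
    by (simp add: mean_sq_def norm_minus_commute)
  also have "mean_sq (?e t) \<le> L\<^sup>2 * real CARD('d) * (u (Suc t))\<^sup>2 / 4"
    by (rule estimator_mean_sq_error)
  also have "mean_sq (?e (Suc t)) \<le> L\<^sup>2 * real CARD('d) * (u (Suc t))\<^sup>2 / 4"
  proof -
    have "(u (Suc (Suc t)))\<^sup>2 \<le> (u (Suc t))\<^sup>2"
      using u_pos u_decreasing by (intro power_mono) (auto simp: less_imp_le)
    then have "L\<^sup>2 * real CARD('d) * (u (Suc (Suc t)))\<^sup>2 \<le> L\<^sup>2 * real CARD('d) * (u (Suc t))\<^sup>2"
      by (intro mult_left_mono) auto
    then show ?thesis
      using estimator_mean_sq_error[of "Suc t"] by linarith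
  qed
  finally show ?thesis
    by (simp add: algebra_simps)
qed

lemma dispersion_s_Suc:
  "dispersion (s (Suc (Suc t))) \<le> (1 - \<gamma> / 2) * dispersion (s (Suc t)) +
     2 / \<gamma> * (2 * L\<^sup>2 * (2 * dispersion (x (Suc t)) + 2 * dispersion (x t)
                    + \<eta>\<^sup>2 * (norm (avg (g (Suc t))))\<^sup>2)
            + 2 * L\<^sup>2 * real CARD('d) * (u (Suc t))\<^sup>2)"
proof -
  let ?\<Delta> = "\<lambda>i. g (Suc (Suc t)) i - g (Suc t) i"
  have "dispersion ?\<Delta> \<le> mean_sq ?\<Delta>"
    by (rule dispersion_le_mean_sq)
  also have "\<dots> \<le> 2 * L\<^sup>2 * mean_sq (\<lambda>i. x (Suc t) i - x t i) + 2 * L\<^sup>2 * real CARD('d) * (u (Suc t))\<^sup>2"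
    by (rule mean_sq_g_increment_le)
  also have "\<dots> \<le> 2 * L\<^sup>2 * (2 * dispersion (x (Suc t)) + 2 * dispersion (x t)
      + \<eta>\<^sup>2 * (norm (avg (g (Suc t))))\<^sup>2) + 2 * L\<^sup>2 * real CARD('d) * (u (Suc t))\<^sup>2"
    by (intro add_right_mono mult_left_mono mean_sq_x_increment_le) auto
  finally have "2 / \<gamma> * dispersion ?\<Delta> \<le> 2 / \<gamma> * \<dots>"
    using spectral_gap(2) by (intro mult_left_mono) auto
  then show ?thesis
    using dispersion_mix_add_le[OF ds spectral_gap, of "s (Suc t)" ?\<Delta>] by (simp add: s_Suc[of "Suc t"])
qed

text \<open>Writing the inner product of the true and the estimated gradient by polarization keeps a negative
  multiple of \<open>\<parallel>avg g\<parallel>\<^sup>2\<close>, which later absorbs the averaged step in the recursion for the dispersion of \<open>s\<close>.\<close>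

lemma averaged_descent:
  "F (avg (x (Suc t))) \<le> F (avg (x t)) - \<eta> / 2 * (norm (grad F (avg (x t))))\<^sup>2
     - \<eta> / 2 * (1 - \<eta> * L) * (norm (avg (g (Suc t))))\<^sup>2
     + \<eta> / 2 * (2 * L\<^sup>2 * dispersion (x t) + L\<^sup>2 * real CARD('d) * (u (Suc t))\<^sup>2 / 2)"
proof -
  let ?G = "avg (g (Suc t))" and ?D = "grad F (avg (x t))"
  have "F (avg (x (Suc t))) \<le> F (avg (x t)) - \<eta> * inner ?D ?G + L / 2 * (\<eta>\<^sup>2 * (norm ?G)\<^sup>2)"
    using smooth_quadratic_bound[OF smooth_global_objective[OF smooth], of "avg (x (Suc t))" "avg (x t)",
        THEN abs_le_D1]
    by (simp add: avg_x_Suc power_mult_distrib)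
  also have "inner ?D ?G = ((norm ?D)\<^sup>2 + (norm ?G)\<^sup>2 - (norm (?G - ?D))\<^sup>2) / 2"
    by (simp add: power2_norm_eq_inner inner_diff inner_commute)
  finally have "F (avg (x (Suc t))) \<le> F (avg (x t)) - \<eta> / 2 * (norm ?D)\<^sup>2
      - \<eta> / 2 * (1 - \<eta> * L) * (norm ?G)\<^sup>2 + \<eta> / 2 * (norm (?G - ?D))\<^sup>2"
    by (simp add: algebra_simps power2_eq_square add_divide_distrib diff_divide_distrib)
  also have "\<eta> / 2 * (norm (?G - ?D))\<^sup>2
      \<le> \<eta> / 2 * (2 * L\<^sup>2 * dispersion (x t) + L\<^sup>2 * real CARD('d) * (u (Suc t))\<^sup>2 / 2)"
    using \<eta>_pos by (intro mult_left_mono average_gradient_error) auto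
  finally show ?thesis
    by simp
qed

end

section \<open>The Lyapunov function\<close>

text \<open>With \<open>h = \<eta> L\<close>, these inequalities say that the weights \<open>10 L \<gamma>\<close> and \<open>4 \<eta> \<gamma>\<close> dominate what the
  recursions produce, after division by \<open>L\<close>, \<open>\<eta>\<close> and \<open>\<eta>\<close>: for the dispersion of \<open>x\<close>, for that of
  \<open>s\<close>, and for the squared averaged step. The recursion for the dispersion of \<open>s\<close> charges \<open>32 h\<close> to the
  new and \<open>32 h\<close> to the old dispersion of \<open>x\<close>, and the descent inequality one more \<open>h\<close> to the old one.
  For small \<open>\<gamma>\<close> and \<open>h = \<gamma>\<^sup>2 / 14\<close> the first two read \<open>65 / 14 \<le> 5\<close> and \<open>10 / 7 \<le> 2\<close> to leading order, so
  the numbers 10 and 4 leave room in both.\<close>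

lemma lyapunov_coefficients:
  fixes \<gamma> h lam :: real
  assumes "0 < \<gamma>" "\<gamma> \<le> 1" "0 < h" "h \<le> \<gamma>\<^sup>2 / 14" "1 - \<gamma>\<^sup>2 / 25 \<le> lam"
  shows "33 * h + (10 * \<gamma> + 32 * h) * (1 - \<gamma> / 2) \<le> 10 * \<gamma> * lam"
    and "(10 * \<gamma> + 32 * h) * (2 * h / \<gamma>) + 4 * \<gamma> * (1 - \<gamma> / 2) \<le> 4 * \<gamma> * lam"
    and "16 * h\<^sup>2 \<le> (1 - h) / 2"
proof -
  have lam: "\<gamma> * (1 - \<gamma>\<^sup>2 / 25) \<le> \<gamma> * lam"
    using assms by (intro mult_left_mono) auto
  have h14: "h \<le> 1 / 14"
    using assms power_le_one[of \<gamma> 2] by linarith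
  have "(65 - 16 * \<gamma>) * h \<le> (65 - 16 * \<gamma>) * (\<gamma>\<^sup>2 / 14)"
    using assms by (intro mult_left_mono) auto
  also have "\<dots> = (65 - 16 * \<gamma>) / 14 * \<gamma>\<^sup>2"
    by simp
  also have "\<dots> \<le> (5 - 2 / 5 * \<gamma>) * \<gamma>\<^sup>2"
    using assms by (intro mult_right_mono) auto
  finally show "33 * h + (10 * \<gamma> + 32 * h) * (1 - \<gamma> / 2) \<le> 10 * \<gamma> * lam"
    using lam by (simp add: field_simps power2_eq_square)
  have "h / \<gamma> \<le> \<gamma> / 14"
    using assms by (simp add: field_simps power2_eq_square)
  then have "(10 * \<gamma> + 32 * h) * (2 * (h / \<gamma>)) \<le> (10 * \<gamma> + 32 * (\<gamma>\<^sup>2 / 14)) * (2 * (\<gamma> / 14))"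
    using assms by (intro mult_mono) auto
  also have "\<dots> = (10 / 7 + 16 / 49 * \<gamma>) * \<gamma>\<^sup>2"
    by (simp add: algebra_simps power2_eq_square)
  also have "\<dots> \<le> (2 - 4 / 25 * \<gamma>) * \<gamma>\<^sup>2"
    using assms by (intro mult_right_mono) auto
  finally show "(10 * \<gamma> + 32 * h) * (2 * h / \<gamma>) + 4 * \<gamma> * (1 - \<gamma> / 2) \<le> 4 * \<gamma> * lam"
    using lam by (simp add: algebra_simps power2_eq_square)
  have "h * h \<le> 1 / 14 * (1 / 14)"
    using assms h14 by (intro mult_mono) auto
  then show "16 * h\<^sup>2 \<le> (1 - h) / 2"
    using h14 by (simp add: power2_eq_square)
qed

text \<open>Here \<open>\<delta>\<close> is the gap, \<open>a\<close> and \<open>b\<close> are the dispersions of \<open>x(t)\<close> and \<open>s(t+1)\<close>, \<open>G\<close> is the squared norm of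
  the averaged estimate and \<open>N = d u\<^sup>2\<close>. The dispersion of \<open>s\<close> is taken one step ahead because the
  recursion for \<open>x(t+1)\<close> uses \<open>s(t+1)\<close>; its own update then refers to \<open>a'\<close>, so \<open>b'\<close> is eliminated first
  and \<open>a'\<close> afterwards, with a weight enlarged by \<open>32 \<eta> L\<^sup>2\<close>. The noise \<open>65 / 4\<close> is \<open>1 / 4\<close> from the descent and
  16 from the tracking recursion.\<close>

lemma lyapunov_contraction:
  fixes \<gamma> \<eta> L lam \<mu> \<delta> a b \<delta>' a' b' G N :: real
  assumes \<gamma>: "0 < \<gamma>" "\<gamma> \<le> 1" and pos: "0 < \<eta>" "0 < L" and step: "\<eta> * L \<le> \<gamma>\<^sup>2 / 14"
    and lam: "1 - \<gamma>\<^sup>2 / 25 \<le> lam" "1 - \<eta> * \<mu> \<le> lam"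
    and nonneg: "0 \<le> \<delta>" "0 \<le> a" "0 \<le> b" "0 \<le> G"
    and \<delta>': "\<delta>' \<le> (1 - \<eta> * \<mu>) * \<delta> - \<eta> / 2 * (1 - \<eta> * L) * G + \<eta> / 2 * (2 * L\<^sup>2 * a + L\<^sup>2 * N / 2)"
    and a': "a' \<le> (1 - \<gamma> / 2) * a + 2 / \<gamma> * (\<eta>\<^sup>2 * b)"
    and b': "b' \<le> (1 - \<gamma> / 2) * b + 2 / \<gamma> * (2 * L\<^sup>2 * (2 * a' + 2 * a + \<eta>\<^sup>2 * G) + 2 * L\<^sup>2 * N)"
  shows "\<delta>' + 10 * L * \<gamma> * a' + 4 * \<eta> * \<gamma> * b'
    \<le> lam * (\<delta> + 10 * L * \<gamma> * a + 4 * \<eta> * \<gamma> * b) + 65 / 4 * \<eta> * L\<^sup>2 * N"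
proof -
  define h where "h = \<eta> * L"
  have h: "0 < h" "h \<le> \<gamma>\<^sup>2 / 14"
    using pos step by (auto simp: h_def)
  note coeffs = lyapunov_coefficients[OF \<gamma> h lam(1)]
  have "4 * \<eta> * \<gamma> * b' \<le> 4 * \<eta> * \<gamma> * ((1 - \<gamma> / 2) * b
      + 2 / \<gamma> * (2 * L\<^sup>2 * (2 * a' + 2 * a + \<eta>\<^sup>2 * G) + 2 * L\<^sup>2 * N))"
    using pos \<gamma> by (intro mult_left_mono b') auto
  also have "\<dots> = 4 * \<eta> * \<gamma> * (1 - \<gamma> / 2) * b
      + 16 * \<eta> * L\<^sup>2 * (2 * a' + 2 * a + \<eta>\<^sup>2 * G + N)"
    using \<gamma> by (simp add: field_simps)
  finally have 1: "4 * \<eta> * \<gamma> * b' \<le> \<dots>" .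
  have "(10 * L * \<gamma> + 32 * \<eta> * L\<^sup>2) * a'
      \<le> (10 * L * \<gamma> + 32 * \<eta> * L\<^sup>2) * ((1 - \<gamma> / 2) * a + 2 / \<gamma> * (\<eta>\<^sup>2 * b))"
    using pos \<gamma> by (intro mult_left_mono a') auto
  also have "\<dots> = L * ((10 * \<gamma> + 32 * h) * (1 - \<gamma> / 2)) * a
      + \<eta> * ((10 * \<gamma> + 32 * h) * (2 * h / \<gamma>)) * b"
    by (simp add: h_def power2_eq_square algebra_simps)
  finally have 2: "(10 * L * \<gamma> + 32 * \<eta> * L\<^sup>2) * a' \<le> \<dots>" .
  have "L * (33 * h + (10 * \<gamma> + 32 * h) * (1 - \<gamma> / 2)) * a \<le> L * (10 * \<gamma> * lam) * a"
    using pos nonneg coeffs(1) by (intro mult_right_mono mult_left_mono) auto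
  then have 3: "33 * (\<eta> * L\<^sup>2) * a + L * ((10 * \<gamma> + 32 * h) * (1 - \<gamma> / 2)) * a \<le> L * (10 * \<gamma> * lam) * a"
    by (simp add: h_def power2_eq_square algebra_simps)
  have "\<eta> * ((10 * \<gamma> + 32 * h) * (2 * h / \<gamma>) + 4 * \<gamma> * (1 - \<gamma> / 2)) * b \<le> \<eta> * (4 * \<gamma> * lam) * b"
    using pos nonneg coeffs(2) by (intro mult_right_mono mult_left_mono) auto
  then have 4: "\<eta> * ((10 * \<gamma> + 32 * h) * (2 * h / \<gamma>)) * b + 4 * \<eta> * \<gamma> * (1 - \<gamma> / 2) * b
      \<le> \<eta> * (4 * \<gamma> * lam) * b"
    by (simp only: distrib_left distrib_right mult.assoc mult.left_commute)
  have "\<eta> * (16 * h\<^sup>2) * G \<le> \<eta> * ((1 - h) / 2) * G"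
    using pos nonneg coeffs(3) by (intro mult_right_mono mult_left_mono) auto
  then have 5: "16 * \<eta> * L\<^sup>2 * \<eta>\<^sup>2 * G \<le> \<eta> / 2 * (1 - \<eta> * L) * G"
    by (simp add: h_def power2_eq_square algebra_simps)
  have 6: "(1 - \<eta> * \<mu>) * \<delta> \<le> lam * \<delta>"
    using lam nonneg by (intro mult_right_mono) auto
  have "\<delta>' + 10 * L * \<gamma> * a' + 4 * \<eta> * \<gamma> * b'
      \<le> \<delta>' + (10 * L * \<gamma> + 32 * \<eta> * L\<^sup>2) * a' + 4 * \<eta> * \<gamma> * (1 - \<gamma> / 2) * b
        + 32 * (\<eta> * L\<^sup>2) * a + 16 * \<eta> * L\<^sup>2 * \<eta>\<^sup>2 * G + 16 * \<eta> * L\<^sup>2 * N"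
    using 1 by (simp add: algebra_simps)
  also have "\<dots> \<le> \<delta>' + (L * (10 * \<gamma> * lam) * a + \<eta> * (4 * \<gamma> * lam) * b) - \<eta> * L\<^sup>2 * a
        + \<eta> / 2 * (1 - \<eta> * L) * G + 16 * \<eta> * L\<^sup>2 * N"
    using 2 3 4 5 by linarith
  also have "\<dots> \<le> lam * \<delta> + (L * (10 * \<gamma> * lam) * a + \<eta> * (4 * \<gamma> * lam) * b) + 65 / 4 * \<eta> * L\<^sup>2 * N"
    using \<delta>' 6 by (simp add: algebra_simps)
  finally show ?thesis
    by (simp add: algebra_simps)
qed

lemma convolution_Suc:
  fixes w :: "nat \<Rightarrow> real"
  shows "(\<Sum>\<tau><Suc t. q ^ \<tau> * w (Suc t - \<tau>)) = w (Suc t) + q * (\<Sum>\<tau><t. q ^ \<tau> * w (t - \<tau>))"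
  unfolding sum.lessThan_Suc_shift by (simp add: sum_distrib_left mult.assoc)

lemma perturbed_contraction_bound:
  fixes V w :: "nat \<Rightarrow> real"
  assumes "0 \<le> q" and step: "\<And>t. V (Suc t) \<le> q * V t + N * w (Suc t)"
  shows "V t \<le> V 0 * q ^ t + N * (\<Sum>\<tau><t. q ^ \<tau> * w (t - \<tau>))"
proof (induction t)
  case 0
  then show ?case
    by simp
next
  case (Suc t)
  then have "q * V t \<le> q * (V 0 * q ^ t + N * (\<Sum>\<tau><t. q ^ \<tau> * w (t - \<tau>)))"
    using \<open>0 \<le> q\<close> by (intro mult_left_mono)
  with step[of t] show ?case
    unfolding convolution_Suc by (simp add: algebra_simps)
qed

section \<open>Convergence rate\<close>

theorem theorem4:
  fixes E :: "('n::finite \<times> 'n) set"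
    and W :: "real^'n^'n"
    and f :: "'n \<Rightarrow> real^'d \<Rightarrow> real"
    and x s :: "nat \<Rightarrow> 'n \<Rightarrow> real^'d"
    and u :: "nat \<Rightarrow> real"
    and xstar :: "real^'d"
    and L \<mu> \<eta> \<alpha> \<rho> lam :: real
  assumes "connected_graph E"
    and "consensus_matrix E W"
    and "\<rho> = mixing_rate W"
    and "L > 0"
    and "\<And>i. smooth L (f i)"
    and "gradient_dominated \<mu> (global_objective f)"
    and "global_minimizer (global_objective f) xstar"
    and "(\<forall>y. global_objective f y = global_objective f xstar) \<longrightarrow> \<mu> \<le> L"
    and "\<eta> > 0"
    and "0 < \<alpha>" "\<alpha> \<le> 1"
    and "\<eta> * L = \<alpha> * (\<mu> / L) powr (1 / 3) * ((1 - \<rho>\<^sup>2)\<^sup>2 / 14)"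
    and "\<And>t. t \<ge> 1 \<Longrightarrow> u t > 0"
    and "antimono_on {1..} u"
    and "gradient_tracking_run W f \<eta> u x s"
    and "lam = 1 - \<alpha> * ((1 - \<rho>\<^sup>2) / 5)\<^sup>2 * (\<mu> / L) powr (4 / 3)"
  shows
    "(\<exists>C. \<forall>t. global_objective f (avg (x t)) - global_objective f xstar
        \<le> C * lam ^ t
          + 5 * (1 - \<rho>\<^sup>2) * L * real CARD('d) * (\<Sum>\<tau><t. lam ^ \<tau> * (u (t - \<tau>))\<^sup>2)) \<and>
     (\<exists>C. \<forall>t. (1 / real CARD('n)) * (\<Sum>i\<in>UNIV. (norm (x t i - avg (x t)))\<^sup>2)
        \<le> C * lam ^ t
          + 3 * \<eta> * L * real CARD('d) / (1 - \<rho>\<^sup>2) * (\<Sum>\<tau><t. lam ^ \<tau> * (u (t - \<tau>))\<^sup>2)) \<and>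
     (\<exists>C. \<forall>t\<ge>1. (1 / real CARD('n)) *
            (\<Sum>i\<in>UNIV. (norm (s t i - grad (global_objective f) (avg (x (t - 1)))))\<^sup>2)
        \<le> C * lam ^ t
          + 18 * L\<^sup>2 * real CARD('d) / (1 - \<rho>\<^sup>2) * (\<Sum>\<tau><t. lam ^ \<tau> * (u (t - \<tau>))\<^sup>2))"
proof -
  define \<gamma> where "\<gamma> = 1 - \<rho>\<^sup>2"
  define \<kappa> where "\<kappa> = \<mu> / L"
  have \<mu>: "\<mu> > 0"
    using assms(6) by (simp add: gradient_dominated_def)
  have sm: "\<forall>i. smooth L (f i)"
    using assms(5) by blast
  have smF: "smooth L (global_objective f)"
    by (rule smooth_global_objective[OF sm])
  have "\<mu> \<le> L"
    using assms(8) gradient_dominated_le_smooth[OF smF assms(4,6)] by blast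
  then have \<kappa>: "0 < \<kappa>" "\<kappa> \<le> 1"
    using \<mu> \<open>L > 0\<close> by (auto simp: \<kappa>_def)
  have ds: "doubly_stochastic W"
    using assms(2) by (simp add: consensus_matrix_def)
  have step: "\<eta> * L = \<alpha> * \<kappa> powr (1 / 3) * (\<gamma>\<^sup>2 / 14)"
    using assms(12) by (simp add: \<kappa>_def \<gamma>_def)
  have "\<rho>\<^sup>2 \<le> 1"
    using mixing_rate_nonneg[of W] mixing_rate_le_1[OF ds] assms(3) by (simp add: power_le_one)
  \<comment> \<open>A mixing rate of 1 would force the step size to be 0.\<close>
  moreover have "\<gamma> \<noteq> 0"
    using step \<open>\<eta> > 0\<close> \<open>L > 0\<close> by auto
  ultimately have \<gamma>: "0 < \<gamma>" "\<gamma> \<le> 1"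
    by (auto simp: \<gamma>_def)
  have "\<alpha> * \<kappa> powr (1 / 3) \<le> 1"
    using assms(10,11) \<kappa> by (intro mult_le_one powr_le1) auto
  then have hle: "\<eta> * L \<le> \<gamma>\<^sup>2 / 14"
    unfolding step using mult_right_mono[of "\<alpha> * \<kappa> powr (1 / 3)" 1 "\<gamma>\<^sup>2 / 14"] by simp
  have pw: "\<kappa> powr (4 / 3) = \<kappa> * \<kappa> powr (1 / 3)"
    using \<kappa> powr_add[of \<kappa> 1 "1 / 3"] by simp
  have lam: "lam = 1 - \<gamma>\<^sup>2 / 25 * (\<alpha> * \<kappa> powr (4 / 3))"
    using assms(16) by (simp add: \<kappa>_def \<gamma>_def power_divide)
  have "\<alpha> * \<kappa> powr (4 / 3) \<le> 1"
    using assms(10,11) \<kappa> by (intro mult_le_one powr_le1) auto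
  then have lam1: "1 - \<gamma>\<^sup>2 / 25 \<le> lam"
    unfolding lam using mult_left_mono[of "\<alpha> * \<kappa> powr (4 / 3)" 1 "\<gamma>\<^sup>2 / 25"] by simp
  have "\<eta> * \<mu> = (\<eta> * L) * \<kappa>"
    using \<open>L > 0\<close> by (simp add: \<kappa>_def)
  also have "\<dots> = \<gamma>\<^sup>2 / 14 * (\<alpha> * \<kappa> powr (4 / 3))"
    by (simp add: step pw)
  finally have \<eta>\<mu>: "\<eta> * \<mu> = \<gamma>\<^sup>2 / 14 * (\<alpha> * \<kappa> powr (4 / 3))" .
  have "\<gamma>\<^sup>2 / 25 * (\<alpha> * \<kappa> powr (4 / 3)) \<le> \<gamma>\<^sup>2 / 14 * (\<alpha> * \<kappa> powr (4 / 3))"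
    using assms(10) by (intro mult_right_mono) auto
  then have lam2: "1 - \<eta> * \<mu> \<le> lam"
    unfolding lam \<eta>\<mu> by linarith
  have \<gamma>sq: "\<gamma>\<^sup>2 \<le> \<gamma>" "\<gamma>\<^sup>2 \<le> 1"
    using \<gamma> by (simp_all add: power2_eq_square mult_le_one)
  have lam_pos: "24 / 25 \<le> lam"
    using lam1 \<gamma>sq by linarith

  obtain g where g: "\<And>i. s 0 i = 0" "\<And>i. g 0 i = 0"
      "\<And>t i. t \<ge> 1 \<Longrightarrow> g t i = grad_est_2d (f i) (x (t - 1) i) (u t)"
      "\<And>t i. t \<ge> 1 \<Longrightarrow> s t i = (\<Sum>j\<in>UNIV. W $ i $ j *\<^sub>R (s (t - 1) j + g t j - g (t - 1) j))"
      "\<And>t i. t \<ge> 1 \<Longrightarrow> x t i = (\<Sum>j\<in>UNIV. W $ i $ j *\<^sub>R (x (t - 1) j - \<eta> *\<^sub>R s t j))"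
    using assms(15) unfolding gradient_tracking_run_def by blast
  interpret gradient_tracking W f L \<eta> \<gamma> u x s g
  proof
    show "u (Suc (Suc t)) \<le> u (Suc t)" for t
      using assms(14) by (auto simp: monotone_on_def)
  qed (use ds \<gamma> sm assms(3,4,9,13) g in \<open>auto simp: \<gamma>_def mix_def fun_eq_iff add_diff_eq\<close>)

  define gap where "gap t = F (avg (x t)) - F xstar" for t
  define V where "V t = gap t + 10 * L * \<gamma> * dispersion (x t) + 4 * \<eta> * \<gamma> * dispersion (s (Suc t))" for t
  define S where "S t = (\<Sum>\<tau><t. lam ^ \<tau> * (u (t - \<tau>))\<^sup>2)" for t
  define N where "N = 65 / 4 * \<eta> * L\<^sup>2 * real CARD('d)"

  have PL: "2 * \<mu> * gap t \<le> (norm (grad F (avg (x t))))\<^sup>2" for t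
  proof -
    obtain x0 where "global_minimizer F x0" "\<forall>x. 2 * \<mu> * (F x - F x0) \<le> (norm (grad F x))\<^sup>2"
      using assms(6) by (auto simp: gradient_dominated_def)
    moreover from this have "F x0 = F xstar"
      using assms(7) by (simp add: global_minimizer_def order_antisym)
    ultimately show ?thesis
      by (simp add: gap_def)
  qed
  have gap_nonneg: "0 \<le> gap t" for t
    using assms(7) by (simp add: gap_def global_minimizer_def)
  have gap_Suc: "gap (Suc t) \<le> (1 - \<eta> * \<mu>) * gap t
      - \<eta> / 2 * (1 - \<eta> * L) * (norm (avg (g (Suc t))))\<^sup>2
      + \<eta> / 2 * (2 * L\<^sup>2 * dispersion (x t) + L\<^sup>2 * (real CARD('d) * (u (Suc t))\<^sup>2) / 2)" for t
  proof -
    have "\<eta> / 2 * (2 * \<mu> * gap t) \<le> \<eta> / 2 * (norm (grad F (avg (x t))))\<^sup>2"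
      using \<open>\<eta> > 0\<close> by (intro mult_left_mono PL) auto
    then show ?thesis
      using averaged_descent[of t] by (simp add: gap_def algebra_simps)
  qed
  have V_Suc: "V (Suc t) \<le> lam * V t + N * (u (Suc t))\<^sup>2" for t
  proof -
    have "V (Suc t) \<le> lam * V t + 65 / 4 * \<eta> * L\<^sup>2 * (real CARD('d) * (u (Suc t))\<^sup>2)"
      unfolding V_def
      by (rule lyapunov_contraction[OF \<gamma> \<open>\<eta> > 0\<close> \<open>L > 0\<close> hle lam1 lam2 gap_nonneg dispersion_nonneg
            dispersion_nonneg zero_le_power2 gap_Suc dispersion_x_Suc])
         (use dispersion_s_Suc[of t] in \<open>simp add: mult.assoc\<close>)
    then show ?thesis
      by (simp add: N_def mult.assoc)
  qed
  have V_bound: "V t \<le> V 0 * lam ^ t + N * S t" for t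
    unfolding S_def
    by (rule perturbed_contraction_bound[where w = "\<lambda>t. (u t)\<^sup>2", OF _ V_Suc]) (use lam_pos in simp)
  have S_nonneg: "0 \<le> S t" for t
    unfolding S_def using lam_pos by (intro sum_nonneg) auto
  have S_Suc: "S (Suc t) = (u (Suc t))\<^sup>2 + lam * S t" for t
    unfolding S_def by (rule convolution_Suc)

  have gap_le: "gap t \<le> V t" and x_le: "10 * L * \<gamma> * dispersion (x t) \<le> V t"
    and s_le: "4 * \<eta> * \<gamma> * dispersion (s (Suc t)) \<le> V t" for t
    using gap_nonneg[of t] \<gamma> \<open>\<eta> > 0\<close> \<open>L > 0\<close> dispersion_nonneg[of "x t"]
      dispersion_nonneg[of "s (Suc t)"]
    by (auto simp: V_def)

  have 1: "gap t \<le> V 0 * lam ^ t + 5 * \<gamma> * L * real CARD('d) * S t" for t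
  proof -
    have "65 / 4 * (\<eta> * L) \<le> 5 * \<gamma>"
      using hle \<gamma>sq \<gamma> by linarith
    then have "65 / 4 * (\<eta> * L) * (L * real CARD('d) * S t) \<le> 5 * \<gamma> * (L * real CARD('d) * S t)"
      using \<open>L > 0\<close> S_nonneg by (intro mult_right_mono) auto
    then show ?thesis
      using gap_le[of t] V_bound[of t] by (simp add: N_def power2_eq_square algebra_simps)
  qed
  have 2: "dispersion (x t) \<le> V 0 / (10 * L * \<gamma>) * lam ^ t + 3 * \<eta> * L * real CARD('d) / \<gamma> * S t" for t
  proof -
    have "dispersion (x t) \<le> (V 0 * lam ^ t + N * S t) / (10 * L * \<gamma>)"
      using order_trans[OF x_le V_bound, of t] \<gamma> \<open>L > 0\<close>
      by (simp add: pos_le_divide_eq mult.commute)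
    also have "\<dots> = V 0 / (10 * L * \<gamma>) * lam ^ t + 13 / 8 * (\<eta> * L * real CARD('d) / \<gamma> * S t)"
      using \<gamma> \<open>L > 0\<close> by (simp add: N_def power2_eq_square field_simps)
    also have "13 / 8 * (\<eta> * L * real CARD('d) / \<gamma> * S t) \<le> 3 * (\<eta> * L * real CARD('d) / \<gamma> * S t)"
      using \<gamma> \<open>\<eta> > 0\<close> \<open>L > 0\<close> S_nonneg by (intro mult_right_mono) auto
    finally show ?thesis
      by simp
  qed
  \<comment> \<open>The deviation of \<open>s\<close> from the gradient is at most the dispersion of \<open>s\<close> plus \<open>2 L\<^sup>2\<close> times that of \<open>x\<close>, up
    to noise; \<open>K\<close> is the resulting sum \<open>1 / (4 \<eta> \<gamma>) + 2 L\<^sup>2 / (10 L \<gamma>)\<close> of inverse weights.\<close>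
  define K where "K = 1 / (4 * \<eta> * \<gamma>) + L / (5 * \<gamma>)"
  have K: "0 \<le> K"
    using \<gamma> \<open>\<eta> > 0\<close> \<open>L > 0\<close> by (simp add: K_def)
  \<comment> \<open>The bound by \<open>V t\<close> only involves radii up to time \<open>t\<close>. In the sum up to \<open>t + 1\<close> these carry an extra
    factor \<open>lam\<close>, which is harmless since \<open>lam \<ge> 24 / 25\<close>; the new radius enters only through the
    estimator error.\<close>
  have 3: "mean_sq (\<lambda>i. s (Suc t) i - grad F (avg (x t)))
      \<le> K * V 0 / lam * lam ^ Suc t + 18 * L\<^sup>2 * real CARD('d) / \<gamma> * S (Suc t)" for t
  proof -
    have "mean_sq (\<lambda>i. s (Suc t) i - grad F (avg (x t)))
        \<le> dispersion (s (Suc t)) + (2 * L\<^sup>2 * dispersion (x t) + L\<^sup>2 * real CARD('d) * (u (Suc t))\<^sup>2 / 2)"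
      using average_gradient_error[of t] by (simp add: mean_sq_shift avg_s)
    also have "\<dots> \<le> K * V t + L\<^sup>2 * real CARD('d) / 2 * (u (Suc t))\<^sup>2"
    proof -
      have "dispersion (s (Suc t)) \<le> V t / (4 * \<eta> * \<gamma>)"
        using s_le[of t] \<gamma> \<open>\<eta> > 0\<close> by (simp add: pos_le_divide_eq mult.commute)
      moreover have "2 * L\<^sup>2 * dispersion (x t) \<le> L / (5 * \<gamma>) * V t"
      proof -
        have "L / (5 * \<gamma>) * (10 * L * \<gamma> * dispersion (x t)) \<le> L / (5 * \<gamma>) * V t"
          using \<gamma> \<open>L > 0\<close> by (intro mult_left_mono x_le) auto
        then show ?thesis
          using \<gamma> by (simp add: power2_eq_square)
      qed
      ultimately show ?thesis
        by (simp add: K_def algebra_simps)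
    qed
    also have "K * V t \<le> K * V 0 * lam ^ t + (K * N) * S t"
      using mult_left_mono[OF V_bound K, of t] by (simp add: algebra_simps)
    also have "(K * N) * S t \<le> 18 * (L\<^sup>2 * real CARD('d) / \<gamma>) * lam * S t"
    proof -
      have "K * N = (65 / 16 + 13 / 4 * (\<eta> * L)) * (L\<^sup>2 * real CARD('d) / \<gamma>)"
        using \<gamma> \<open>\<eta> > 0\<close> by (simp add: K_def N_def field_simps)
      also have "\<dots> \<le> (18 * lam) * (L\<^sup>2 * real CARD('d) / \<gamma>)"
        using hle \<gamma>sq lam_pos \<gamma> by (intro mult_right_mono) auto
      finally show ?thesis
        by (intro mult_right_mono S_nonneg) (simp add: mult_ac)
    qed
    also have "L\<^sup>2 * real CARD('d) / 2 * (u (Suc t))\<^sup>2 \<le> 18 * (L\<^sup>2 * real CARD('d) / \<gamma>) * (u (Suc t))\<^sup>2"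
    proof -
      have "L\<^sup>2 * real CARD('d) * (1 / 2) \<le> L\<^sup>2 * real CARD('d) * (18 / \<gamma>)"
        using \<gamma> by (intro mult_left_mono) (auto simp: field_simps)
      then show ?thesis
        by (intro mult_right_mono) (auto simp: mult_ac)
    qed
    finally show ?thesis
      using lam_pos by (simp add: S_Suc algebra_simps add_divide_distrib)
  qed
  show ?thesis
  proof (intro conjI)
    show "\<exists>C. \<forall>t. F (avg (x t)) - F xstar
        \<le> C * lam ^ t + 5 * (1 - \<rho>\<^sup>2) * L * real CARD('d) * (\<Sum>\<tau><t. lam ^ \<tau> * (u (t - \<tau>))\<^sup>2)"
      using 1 unfolding gap_def \<gamma>_def S_def by blast
    show "\<exists>C. \<forall>t. (1 / real CARD('n)) * (\<Sum>i\<in>UNIV. (norm (x t i - avg (x t)))\<^sup>2)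
        \<le> C * lam ^ t + 3 * \<eta> * L * real CARD('d) / (1 - \<rho>\<^sup>2) * (\<Sum>\<tau><t. lam ^ \<tau> * (u (t - \<tau>))\<^sup>2)"
      using 2 unfolding dispersion_def mean_sq_def avg_real \<gamma>_def S_def by blast
    show "\<exists>C. \<forall>t\<ge>1. (1 / real CARD('n)) * (\<Sum>i\<in>UNIV. (norm (s t i - grad F (avg (x (t - 1)))))\<^sup>2)
        \<le> C * lam ^ t + 18 * L\<^sup>2 * real CARD('d) / (1 - \<rho>\<^sup>2) * (\<Sum>\<tau><t. lam ^ \<tau> * (u (t - \<tau>))\<^sup>2)"
    proof (intro exI allI impI)
      fix t :: nat
      assume "1 \<le> t"
      then obtain t' where "t = Suc t'"
        by (cases t) auto
      then show "(1 / real CARD('n)) * (\<Sum>i\<in>UNIV. (norm (s t i - grad F (avg (x (t - 1)))))\<^sup>2)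
          \<le> K * V 0 / lam * lam ^ t + 18 * L\<^sup>2 * real CARD('d) / (1 - \<rho>\<^sup>2) * (\<Sum>\<tau><t. lam ^ \<tau> * (u (t - \<tau>))\<^sup>2)"
        using 3[of t'] by (simp add: mean_sq_def avg_real S_def \<gamma>_def)
    qed
  qed
qed

end
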